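(* Let $e$ be a positive integer. Then there exists a $(\mathbb{Z}_{2^e}\times\mathbb{Z}_2,2,0)$ contracted difference matrix.
   Context: All groups are finite, and abelian groups are written additively. Difference matrix: for a non-trivial group $G$, a $(G,m,\lambda)$ difference matrix is an $m\times\lambda|G|$ matrix $(a_{ij})$ with entries in $G$ such that, for all distinct rows $i$ and $\ell$, the multiset of differences $\{a_{ij}-a_{\ell j} : 0\le j\le \lambda|G|-1\}$ contains each element of $G$ exactly $\lambda$ times. $p$-expansion: let $p$ be prime and let $M$ be a $k\times\ell$ matrix over an abelian $p$-group $G$. The $p$-expansion $f_p(M)$ is the $p^k\times p^\ell$ matrix over $G$ whose rows are indexed by $\mathbf{r}\in\mathbb{Z}_p^k$ and whose columns are indexed by $\mathbf{c}\in\mathbb{Z}_p^\ell$, with $(\mathbf{r},\mathbf{c})$ entry $\mathbf{r}M\mathbf{c}^{\intercal}=\sum_{i,j} r_i c_j M_{ij}$, where $\mathbf r,\mathbf c$ are row vectors whose entries are taken as the integer representatives in $\{0,1,\dots,p-1\}$, and integers act on $G$ in the usual way. Contracted difference matrix: let $p$ be prime and let $G$ be an abelian group of order $p^n$. A $k\times(n+s)$ matrix $M$ over $G$ is a $(G,k,s)$ contracted difference matrix if the $p^k\times p^{n+s}$ matrix $f_p(M)$ is a $(G,p^k,p^s)$ difference matrix. *)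

theory Defs
  imports "HOL-Algebra.Elementary_Groups" "HOL-Algebra.FiniteProduct" "HOL-Computational_Algebra.Primes"
begin

text \<open>
  Groups are HOL-Algebra groups, hence written multiplicatively: a difference \<open>x - y\<close> appears as
  \<open>x \<otimes> inv y\<close>, an integer multiple as a power, and a sum as \<^const>\<open>finprod\<close>.

  A matrix is a function of a row and a column index, only its values on the given index sets
  being relevant. The index sets of a difference matrix are arbitrary finite sets of the right
  cardinality, because the rows and columns of a \<open>p\<close>-expansion are indexed by vectors rather than
  by numbers; the defining condition does not depend on how rows and columns are ordered.
\<close>

definition difference_matrix ::
    "('a, 'b) monoid_scheme \<Rightarrow> nat \<Rightarrow> nat \<Rightarrow> 'r set \<Rightarrow> 'c set \<Rightarrow> ('r \<Rightarrow> 'c \<Rightarrow> 'a) \<Rightarrow> bool" where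
  "difference_matrix G m lam R C A \<longleftrightarrow>
     group G \<and> finite (carrier G) \<and> order G > 1 \<and>
     finite R \<and> card R = m \<and> finite C \<and> card C = lam * order G \<and>
     A \<in> R \<rightarrow> C \<rightarrow> carrier G \<and>
     (\<forall>i\<in>R. \<forall>l\<in>R. i \<noteq> l \<longrightarrow>
        (\<forall>g\<in>carrier G. card {j\<in>C. A i j \<otimes>\<^bsub>G\<^esub> inv\<^bsub>G\<^esub> (A l j) = g} = lam))"

text \<open>
  The vectors of length \<open>k\<close> over the integers modulo \<open>p\<close>, with entries given by their
  representatives \<open>0, \<dots>, p - 1\<close>.
\<close>

definition Zp_vectors :: "nat \<Rightarrow> nat \<Rightarrow> (nat \<Rightarrow> nat) set" where
  "Zp_vectors p k = {..<k} \<rightarrow>\<^sub>E {..<p}"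

text \<open>
  The \<open>(r, c)\<close> entry of the \<open>p\<close>-expansion of a \<open>k \<times> l\<close> matrix \<open>M\<close>; the prime \<open>p\<close> enters only
  through the index sets \<open>Zp_vectors p k\<close> and \<open>Zp_vectors p l\<close> from which \<open>r\<close> and \<open>c\<close> are taken.
\<close>

definition expansion ::
    "('a, 'b) monoid_scheme \<Rightarrow> nat \<Rightarrow> nat \<Rightarrow> (nat \<Rightarrow> nat \<Rightarrow> 'a) \<Rightarrow>
     (nat \<Rightarrow> nat) \<Rightarrow> (nat \<Rightarrow> nat) \<Rightarrow> 'a" where
  "expansion G k l M r c =
     finprod G (\<lambda>(i, j). M i j [^]\<^bsub>G\<^esub> (r i * c j)) ({..<k} \<times> {..<l})"

definition contracted_difference_matrix ::
    "nat \<Rightarrow> ('a, 'b) monoid_scheme \<Rightarrow> nat \<Rightarrow> nat \<Rightarrow> (nat \<Rightarrow> nat \<Rightarrow> 'a) \<Rightarrow> bool" where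
  "contracted_difference_matrix p G k s M \<longleftrightarrow>
     prime p \<and> comm_group G \<and>
     (\<exists>n. order G = p ^ n \<and>
        M \<in> {..<k} \<rightarrow> {..<n + s} \<rightarrow> carrier G \<and>
        difference_matrix G (p ^ k) (p ^ s) (Zp_vectors p k) (Zp_vectors p (n + s))
          (expansion G k (n + s) M))"

end

theory Submission
  imports Defs
begin

text \<open>
  Write the group additively as \<open>\<int>\<^bsub>2^e\<^esub> \<times> \<int>\<^sub>2\<close>. The matrix used has columns indexed by
  \<open>0, \<dots>, e\<close>: for \<open>j < e\<close>, column \<open>j\<close> is \<open>((2^j, \<epsilon>), (2^(j+1), \<epsilon>))\<close> with \<open>\<epsilon> = 1\<close> if
  \<open>j = e - 1\<close> and \<open>\<epsilon> = 0\<close> otherwise, and column \<open>e\<close> is \<open>((0, 1), (1, 0))\<close>.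

  The difference of two distinct rows of its \<open>2\<close>-expansion is the map
  \<open>c \<mapsto> \<Sum>\<^sub>j c\<^sub>j (d\<^sub>0 a\<^sub>j + d\<^sub>1 b\<^sub>j)\<close> on \<open>{0, 1}\<^bsup>e+1\<^esup>\<close>, where \<open>a\<close> and \<open>b\<close> are the rows of the
  matrix and \<open>(d\<^sub>0, d\<^sub>1)\<close> is a nonzero vector over \<open>{-1, 0, 1}\<close>. As there are as many vectors
  \<open>c\<close> as group elements, every element is attained exactly once as soon as this map is injective
  (\<open>difference_matrix_if_inj\<close>). By linearity this means that only the zero vector of digits
  \<open>x\<^sub>j \<in> {-1, 0, 1}\<close>, the differences of two vectors \<open>c\<close>, is mapped to zero.

  With \<open>n = \<Sum>\<^bsub>j<e\<^esub> x\<^sub>j 2^j\<close>, the image of \<open>x\<close> is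
  \<open>(d\<^sub>0 n + d\<^sub>1 (2 n + x\<^sub>e), d\<^sub>0 (x\<^bsub>e-1\<^esub> + x\<^sub>e) + d\<^sub>1 x\<^bsub>e-1\<^esub>)\<close>. If it vanishes, then
  congruences modulo \<open>2\<close> and \<open>2^e\<close>, combined with bounds on \<open>n\<close>, force \<open>x\<^sub>e = 0\<close> and \<open>n = 0\<close>
  for each kind of \<open>(d\<^sub>0, d\<^sub>1)\<close> (\<open>combination_zero_imp_digits_zero\<close>). Finally, \<open>0\<close> has no
  signed binary expansion with a given number of digits other than the trivial one
  (\<open>signed_binary_eq_0\<close>).
\<close>

section \<open>Signed binary digits\<close>

lemma abs_signed_binary_less:
  fixes x :: "nat \<Rightarrow> int"
  assumes "\<And>j. j < n \<Longrightarrow> \<bar>x j\<bar> \<le> 1"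
  shows "\<bar>\<Sum>j<n. x j * 2 ^ j\<bar> < 2 ^ n"
  using assms
proof (induction n)
  case (Suc n)
  have "\<bar>\<Sum>j<n. x j * 2 ^ j\<bar> < 2 ^ n" and "\<bar>x n * 2 ^ n\<bar> \<le> 2 ^ n"
    using Suc by (auto simp: abs_mult)
  then have "\<bar>(\<Sum>j<n. x j * 2 ^ j) + x n * 2 ^ n\<bar> < 2 ^ n + 2 ^ n" by linarith
  then show ?case by simp
qed simp

text \<open>
  The leading digit vanishes because the lower ones cannot make up for its value. This is special
  to \<open>0\<close>: signed expansions of other numbers, such as \<open>1 = 2 - 1\<close>, need not be unique.
\<close>

lemma signed_binary_eq_0:
  fixes x :: "nat \<Rightarrow> int"
  assumes "\<And>j. j < n \<Longrightarrow> \<bar>x j\<bar> \<le> 1" and "(\<Sum>j<n. x j * 2 ^ j) = 0" and "i < n"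
  shows "x i = 0"
  using assms
proof (induction n)
  case (Suc n)
  have "\<bar>\<Sum>j<n. x j * 2 ^ j\<bar> < 2 ^ n"
    using Suc.prems by (intro abs_signed_binary_less) simp
  moreover have "(\<Sum>j<n. x j * 2 ^ j) = - (x n * 2 ^ n)"
    using Suc.prems(2) by simp
  ultimately have "\<bar>x n\<bar> * 2 ^ n < 1 * 2 ^ n"
    by (simp add: abs_mult)
  then have "x n = 0"
    by (simp only: mult_less_cancel_right) auto
  with Suc show ?case by (auto simp: less_Suc_eq)
qed simp

section \<open>The matrix\<close>

text \<open>
  Below column \<open>e\<close>, the second row is twice the first in the \<open>\<int>\<^bsub>2^e\<^esub>\<close> coordinate. This makes
  both the sum and the difference of the rows odd multiples of the first row, so that they
  inherit its injectivity. The doubling loses the digit \<open>e - 1\<close> modulo \<open>2^e\<close>; the entries \<open>1\<close>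
  in column \<open>e - 1\<close> of the \<open>\<int>\<^sub>2\<close> coordinate recover it. The coordinates are kept as integers, so
  that linear combinations are formed before reducing.
\<close>

definition entry_fst :: "nat \<Rightarrow> nat \<Rightarrow> nat \<Rightarrow> int" where
  "entry_fst e i j = (if j < e then 2 ^ (i + j) else of_bool (i = 1))"

definition entry_snd :: "nat \<Rightarrow> nat \<Rightarrow> nat \<Rightarrow> int" where
  "entry_snd e i j = of_bool (Suc j = e \<or> j = e \<and> i = 0)"

text \<open>
  Up to sign, \<open>d\<close> selects one of the two rows, their sum or their difference. For the first
  row (\<open>d\<^sub>1 = 0\<close>), the first coordinate determines the digits below \<open>e\<close> and the second one then
  determines digit \<open>e\<close>. For the second row (\<open>d\<^sub>0 = 0\<close>), the first coordinate is \<open>2 n + x\<^sub>e\<close>,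
  whose parity settles digit \<open>e\<close>; it says nothing on digit \<open>e - 1\<close>, which the second coordinate
  supplies. For the sum and the difference, the two occurrences of digit \<open>e - 1\<close> cancel modulo
  \<open>2\<close> in the second coordinate, which leaves \<open>x\<^sub>e\<close>, and then \<open>n\<close> is multiplied by the odd number
  \<open>d\<^sub>0 + 2 d\<^sub>1\<close> in the first.
\<close>

lemma combination_zero_imp_digits_zero:
  fixes x d :: "nat \<Rightarrow> int"
  assumes "e > 0"
    and x: "\<And>j. j \<le> e \<Longrightarrow> \<bar>x j\<bar> \<le> 1"
    and d: "\<bar>d 0\<bar> \<le> 1" "\<bar>d 1\<bar> \<le> 1" "d 0 \<noteq> 0 \<or> d 1 \<noteq> 0"
    and fst0: "2 ^ e dvd (\<Sum>i<2. \<Sum>j<Suc e. d i * x j * entry_fst e i j)"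
    and snd0: "2 dvd (\<Sum>i<2. \<Sum>j<Suc e. d i * x j * entry_snd e i j)"
    and "i \<le> e"
  shows "x i = 0"
proof -
  define n where "n = (\<Sum>j<e. x j * 2 ^ j)"
  obtain k where k: "e = Suc k" using \<open>e > 0\<close> gr0_implies_Suc by blast
  have row0: "(\<Sum>j<e. x j * entry_fst e 0 j) = n"
    and row1: "(\<Sum>j<e. x j * entry_fst e 1 j) = 2 * n"
    by (auto simp: n_def entry_fst_def sum_distrib_left intro!: sum.cong)
  have "(\<Sum>i<2. \<Sum>j<Suc e. d i * x j * entry_fst e i j)
      = (\<Sum>i<2. d i * (\<Sum>j<Suc e. x j * entry_fst e i j))"
    by (simp only: sum_distrib_left mult.assoc)
  also have "\<dots> = d 0 * n + d 1 * (2 * n + x e)"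
    using row0 row1 by (simp add: numeral_2_eq_2) (simp add: entry_fst_def)
  finally have A: "2 ^ e dvd d 0 * n + d 1 * (2 * n + x e)"
    using fst0 by simp
  have low: "(\<Sum>j<k. d i * x j * entry_snd e i j) = 0" for i
    by (intro sum.neutral) (auto simp: entry_snd_def k)
  have "(\<Sum>i<2. \<Sum>j<Suc e. d i * x j * entry_snd e i j) = d 0 * (x k + x e) + d 1 * x k"
    using low[of 0] low[of 1] by (simp add: numeral_2_eq_2 k) (simp add: entry_snd_def k algebra_simps)
  then have B: "even (d 0 * (x k + x e) + d 1 * x k)"
    using snd0 by simp
  have n_less: "\<bar>n\<bar> < 2 ^ e"
    unfolding n_def using x by (intro abs_signed_binary_less) simp
  have n0: "n = 0" if "2 ^ e dvd n"
    using that n_less dvd_imp_le_int[of n "2 ^ e"] by auto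
  have even0: "y = 0" if "even y" "\<bar>y\<bar> \<le> 1" for y :: int
    using that by presburger
  have xk: "\<bar>x k\<bar> \<le> 1" and xe: "\<bar>x e\<bar> \<le> 1"
    using x k by auto
  have pm: "d j = 1 \<or> d j = - 1" if "\<bar>d j\<bar> \<le> 1" "d j \<noteq> 0" for j
    using that by linarith
  have lower: "x j = 0" if "n = 0" "j < e" for j
    using signed_binary_eq_0[of e x j] x that by (simp add: n_def)
  have "n = 0 \<and> x e = 0"
  proof (cases "d 1 = 0")
    case True
    with d pm[of 0] have d0: "d 0 = 1 \<or> d 0 = - 1" by auto
    with A True have "n = 0" by (auto intro: n0)
    moreover from this have "x k = 0" using k by (intro lower) auto
    ultimately show ?thesis using B d0 True xe by (auto intro: even0)
  next
    case d1: False
    with d pm[of 1] have d1': "d 1 = 1 \<or> d 1 = - 1" by auto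
    show ?thesis
    proof (cases "d 0 = 0")
      case True
      have xk0: "x k = 0" using B True d1' xk by (auto intro: even0)
      have A': "2 ^ e dvd 2 * n + x e"
        using A True d1' dvd_minus_iff[of "2 ^ e" "2 * n + x e"] by (auto simp: algebra_simps)
      then have "even (2 * n + x e)"
        using \<open>e > 0\<close> by (meson dvd_power dvd_trans)
      then have xe0: "x e = 0" using xe by (auto intro: even0)
      \<comment> \<open>Halving leaves a congruence modulo \<open>2^k\<close> only, but the leading digit of \<open>n\<close> is \<open>0\<close>.\<close>
      have "n = (\<Sum>j<k. x j * 2 ^ j)" by (simp add: n_def k xk0)
      moreover have "\<bar>\<Sum>j<k. x j * 2 ^ j\<bar> < 2 ^ k"
        using x k by (intro abs_signed_binary_less) simp
      moreover have "2 ^ k dvd n" using A' xe0 k by simp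
      ultimately have "n = 0" using dvd_imp_le_int[of n "2 ^ k"] by auto
      with xe0 show ?thesis by simp
    next
      case False
      with d pm[of 0] have d0': "d 0 = 1 \<or> d 0 = - 1" by auto
      have "even (x e)" using B d0' d1' by auto
      then have xe0: "x e = 0" using xe by (rule even0)
      have "2 ^ e dvd (d 0 + 2 * d 1) * n" using A xe0 by (simp add: algebra_simps)
      moreover have "coprime (2 ^ e) (d 0 + 2 * d 1)" using d0' by auto
      ultimately have "2 ^ e dvd n" using coprime_dvd_mult_right_iff by blast
      then show ?thesis using n0 xe0 by simp
    qed
  qed
  then show ?thesis using lower \<open>i \<le> e\<close> by (cases "i = e") auto
qed

section \<open>From injectivity to difference matrices\<close>

text \<open>
  With \<open>\<lambda> = 1\<close> there are exactly as many columns as group elements, so that an injective row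
  difference is a bijection onto the group.
\<close>

lemma difference_matrix_if_inj:
  assumes "group G" "finite (carrier G)" "order G > 1"
    and "finite R" "card R = m" and "finite C" "card C = order G"
    and A: "A \<in> R \<rightarrow> C \<rightarrow> carrier G"
    and inj: "\<And>i l. i \<in> R \<Longrightarrow> l \<in> R \<Longrightarrow> i \<noteq> l \<Longrightarrow>
      inj_on (\<lambda>j. A i j \<otimes>\<^bsub>G\<^esub> inv\<^bsub>G\<^esub> (A l j)) C"
  shows "difference_matrix G m 1 R C A"
  unfolding difference_matrix_def
proof (intro conjI ballI impI)
  fix i l g assume il: "i \<in> R" "l \<in> R" "i \<noteq> l" and g: "g \<in> carrier G"
  interpret group G by fact
  let ?f = "\<lambda>j. A i j \<otimes>\<^bsub>G\<^esub> inv\<^bsub>G\<^esub> (A l j)"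
  have "?f ` C \<subseteq> carrier G" using A il by (auto simp: Pi_def)
  moreover have "card (?f ` C) = card (carrier G)"
    using inj[OF il] \<open>card C = order G\<close> by (simp add: card_image order_def)
  ultimately have "?f ` C = carrier G"
    using \<open>finite (carrier G)\<close> by (intro card_subset_eq)
  then obtain j where "j \<in> C" "?f j = g" using g by force
  then have "{j \<in> C. ?f j = g} = {j}"
    using inj[OF il] by (auto dest: inj_onD)
  then show "card {j \<in> C. ?f j = g} = 1" by simp
qed (use assms in auto)

section \<open>Computing in a product of two cyclic groups\<close>

text \<open>
  Reduction as a map from pairs of integers, a homomorphism onto the product: it turns products,
  inverses and powers of the group into sums, differences and multiples of integers.
\<close>

definition residues :: "nat \<Rightarrow> nat \<Rightarrow> int \<Rightarrow> int \<Rightarrow> int \<times> int" where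
  "residues m n a b = (a mod int m, b mod int n)"

abbreviation cyclic_product :: "nat \<Rightarrow> nat \<Rightarrow> (int \<times> int) monoid" where
  "cyclic_product m n \<equiv> integer_mod_group m \<times>\<times> integer_mod_group n"

lemma comm_group_cyclic_product: "comm_group (cyclic_product m n)"
  by (rule group.group_comm_groupI) (auto intro: DirProd_group simp: add.commute)

lemma residues_closed: "m > 0 \<Longrightarrow> n > 0 \<Longrightarrow> residues m n a b \<in> carrier (cyclic_product m n)"
  by (simp add: residues_def carrier_integer_mod_group)

lemma residues_mult:
  "residues m n a b \<otimes>\<^bsub>cyclic_product m n\<^esub> residues m n a' b' = residues m n (a + a') (b + b')"
  by (simp add: residues_def mod_add_eq)

lemma residues_diff:
  assumes "m > 0" "n > 0"
  shows "residues m n a b \<otimes>\<^bsub>cyclic_product m n\<^esub> inv\<^bsub>cyclic_product m n\<^esub> (residues m n a' b')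
    = residues m n (a - a') (b - b')"
proof -
  interpret comm_group "cyclic_product m n" by (rule comm_group_cyclic_product)
  have "inv\<^bsub>cyclic_product m n\<^esub> (residues m n a' b') = residues m n (- a') (- b')"
    by (rule inv_equality)
      (simp_all only: residues_mult residues_closed[OF assms], simp add: residues_def)
  then show ?thesis by (simp add: residues_mult del: mult_DirProd')
qed

lemma residues_pow:
  "residues m n a b [^]\<^bsub>cyclic_product m n\<^esub> (k :: nat) = residues m n (int k * a) (int k * b)"
proof (induction k)
  case 0
  show ?case by (simp add: residues_def)
next
  case (Suc k)
  then show ?case by (simp only: nat_pow_Suc residues_mult) (simp add: algebra_simps)
qed

lemma finprod_residues:
  assumes "finite I" "m > 0" "n > 0"
  shows "finprod (cyclic_product m n) (\<lambda>i. residues m n (f i) (g i)) I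
    = residues m n (sum f I) (sum g I)"
proof -
  interpret comm_group "cyclic_product m n" by (rule comm_group_cyclic_product)
  show ?thesis
    using \<open>finite I\<close>
  proof (induction I rule: finite_induct)
    case empty
    show ?case by (simp add: residues_def)
  next
    case (insert i I)
    then show ?case
      using assms
      by (subst finprod_insert)
        (simp_all only: residues_closed residues_mult sum.insert Pi_iff ball_simps simp_thms, simp)
  qed
qed

lemma expansion_residues:
  assumes "m > 0" "n > 0"
  shows "expansion (cyclic_product m n) k l (\<lambda>i j. residues m n (u i j) (v i j)) r c
    = residues m n (\<Sum>i<k. \<Sum>j<l. int (r i) * int (c j) * u i j)
        (\<Sum>i<k. \<Sum>j<l. int (r i) * int (c j) * v i j)"
proof -
  have "expansion (cyclic_product m n) k l (\<lambda>i j. residues m n (u i j) (v i j)) r c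
    = finprod (cyclic_product m n) (\<lambda>z. residues m n
        (case z of (i, j) \<Rightarrow> int (r i) * int (c j) * u i j)
        (case z of (i, j) \<Rightarrow> int (r i) * int (c j) * v i j)) ({..<k} \<times> {..<l})"
    unfolding expansion_def by (simp only: residues_pow case_prod_unfold of_nat_mult)
  then show ?thesis
    using assms by (simp add: finprod_residues sum.cartesian_product)
qed

lemma carrier_cyclic_product:
  "m > 0 \<Longrightarrow> n > 0 \<Longrightarrow> carrier (cyclic_product m n) = {0..<int m} \<times> {0..<int n}"
  by (simp add: carrier_integer_mod_group)

section \<open>Row differences of the expansion\<close>

lemma finite_Zp_vectors: "finite (Zp_vectors p k)"
  by (simp add: Zp_vectors_def finite_PiE)

lemma card_Zp_vectors: "card (Zp_vectors p k) = p ^ k"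
  by (simp add: Zp_vectors_def card_PiE)

lemma abs_diff_Z2_vectors:
  assumes "r \<in> Zp_vectors 2 k" "s \<in> Zp_vectors 2 k" "i < k"
  shows "\<bar>int (r i) - int (s i)\<bar> \<le> 1"
proof -
  have "r i < 2" "s i < 2" using assms by (auto simp: Zp_vectors_def PiE_iff)
  then show ?thesis by linarith
qed

lemma Zp_vectors_eqI:
  assumes "r \<in> Zp_vectors p k" "s \<in> Zp_vectors p k" "\<And>i. i < k \<Longrightarrow> r i = s i"
  shows "r = s"
  using assms unfolding Zp_vectors_def by (auto intro: PiE_ext)

text \<open>
  The row differences of the expansion are additive in the column vector, so that two columns with
  the same value differ by digits to which \<open>combination_zero_imp_digits_zero\<close> applies.
\<close>

lemma inj_on_expansion_row_diff:
  fixes e :: nat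
  defines "G \<equiv> cyclic_product (2 ^ e) 2"
    and "M \<equiv> \<lambda>i j. residues (2 ^ e) 2 (entry_fst e i j) (entry_snd e i j)"
  assumes "e > 0" and rs: "r \<in> Zp_vectors 2 2" "s \<in> Zp_vectors 2 2" "r \<noteq> s"
  shows "inj_on (\<lambda>c. expansion G 2 (Suc e) M r c \<otimes>\<^bsub>G\<^esub> inv\<^bsub>G\<^esub> (expansion G 2 (Suc e) M s c))
    (Zp_vectors 2 (Suc e))"
proof (rule inj_onI)
  fix c c' assume cc: "c \<in> Zp_vectors 2 (Suc e)" "c' \<in> Zp_vectors 2 (Suc e)"
  assume eq: "expansion G 2 (Suc e) M r c \<otimes>\<^bsub>G\<^esub> inv\<^bsub>G\<^esub> (expansion G 2 (Suc e) M s c)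
    = expansion G 2 (Suc e) M r c' \<otimes>\<^bsub>G\<^esub> inv\<^bsub>G\<^esub> (expansion G 2 (Suc e) M s c')"
  define S where "S u b a = (\<Sum>i<2. \<Sum>j<Suc e. int (b i) * int (a j) * u i j)"
    for u :: "nat \<Rightarrow> nat \<Rightarrow> int" and b a :: "nat \<Rightarrow> nat"
  define d where "d i = int (r i) - int (s i)" for i
  define x where "x j = int (c j) - int (c' j)" for j
  have lin: "(S u r c - S u s c) - (S u r c' - S u s c') = (\<Sum>i<2. \<Sum>j<Suc e. d i * x j * u i j)" for u
    unfolding S_def d_def x_def sum_subtractf[symmetric]
    by (intro sum.cong refl) (simp add: algebra_simps)
  have E: "expansion G 2 (Suc e) M b a
      = residues (2 ^ e) 2 (S (entry_fst e) b a) (S (entry_snd e) b a)" for b a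
    unfolding G_def M_def S_def by (rule expansion_residues) simp_all
  have "residues (2 ^ e) 2 (S (entry_fst e) r c - S (entry_fst e) s c)
        (S (entry_snd e) r c - S (entry_snd e) s c)
      = residues (2 ^ e) 2 (S (entry_fst e) r c' - S (entry_fst e) s c')
        (S (entry_snd e) r c' - S (entry_snd e) s c')"
    using eq unfolding E unfolding G_def by (simp only: residues_diff zero_less_power zero_less_numeral)
  then have "2 ^ e dvd (\<Sum>i<2. \<Sum>j<Suc e. d i * x j * entry_fst e i j)"
    and "2 dvd (\<Sum>i<2. \<Sum>j<Suc e. d i * x j * entry_snd e i j)"
    unfolding lin[symmetric] by (simp_all only: residues_def prod.inject mod_eq_dvd_iff) simp_all
  moreover have "d 0 \<noteq> 0 \<or> d 1 \<noteq> 0"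
  proof (rule ccontr)
    assume "\<not> ?thesis"
    then have "r i = s i" if "i < 2" for i
      using that by (auto simp: d_def less_2_cases_iff)
    then have "r = s" using rs(1,2) by (intro Zp_vectors_eqI)
    with rs(3) show False by simp
  qed
  ultimately have "x j = 0" if "j < Suc e" for j
    using that \<open>e > 0\<close> abs_diff_Z2_vectors[OF rs(1,2)] abs_diff_Z2_vectors[OF cc]
    by (intro combination_zero_imp_digits_zero[of e x d j]) (simp_all add: d_def x_def)
  then show "c = c'" using cc by (intro Zp_vectors_eqI) (auto simp: x_def)
qed

theorem theorem5p15:
  fixes e :: nat
  assumes "e > 0"
  shows "\<exists>M. contracted_difference_matrix 2
               (integer_mod_group (2 ^ e) \<times>\<times> integer_mod_group 2) 2 0 M"
proof -
  let ?G = "cyclic_product (2 ^ e) 2"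
  let ?M = "\<lambda>i j. residues (2 ^ e) 2 (entry_fst e i j) (entry_snd e i j)"
  interpret comm_group ?G by (rule comm_group_cyclic_product)
  have card: "order ?G = 2 ^ Suc e"
    unfolding order_def by (subst carrier_cyclic_product) (simp_all add: card_cartesian_product nat_power_eq)
  have "finite (carrier ?G)"
    by (subst carrier_cyclic_product) simp_all
  moreover have "order ?G > 1"
    unfolding card by (rule one_less_power) simp_all
  moreover have "expansion ?G 2 (Suc e) ?M r c \<in> carrier ?G" for r c
    by (subst expansion_residues) (simp_all only: residues_closed zero_less_power zero_less_numeral)
  ultimately have "difference_matrix ?G (2 ^ 2) 1 (Zp_vectors 2 2) (Zp_vectors 2 (Suc e))
      (expansion ?G 2 (Suc e) ?M)"
    using inj_on_expansion_row_diff[OF assms] is_group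
    by (intro difference_matrix_if_inj) (auto simp only: finite_Zp_vectors card_Zp_vectors card)
  moreover have "?M i j \<in> carrier ?G" for i j
    by (rule residues_closed) simp_all
  ultimately have "contracted_difference_matrix 2 ?G 2 0 ?M"
    unfolding contracted_difference_matrix_def
    using card comm_group_cyclic_product by (intro conjI exI[of _ "Suc e"]) (auto simp del: carrier_DirProd)
  then show ?thesis by blast
qed

end
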